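(* Fix a positive integer $s$, a positive real number $\epsilon$, and a probability parameter $p\in(0,1)$, and let $q=1/p$ and $$z=z(n,p)=2\log_q n-2\log_q\log_q n+2\log_q(e/2)+1.$$ Then, with probability tending to $1$ as $n\to\infty$, a random graph $\Gamma\in\mathcal{G}(n,p)$ has an $s$-th multi-clique of size $\lfloor z-\epsilon\rfloor$.
   Context: $\mathcal{G}(n,p)$ is the Erdős–Rényi model: a random graph on vertex set $[n]=\{1,\dots,n\}$ in which each of the $\binom n2$ possible edges is included independently with probability $p$ ($p$ fixed as $n\to\infty$). $\lfloor x\rfloor$ is the integer part of $x$. An $s$-th multi-clique of size $r$ of a graph $\Gamma$ on $[n]$ is an ordered $s$-tuple $(V_1,\dots,V_s)$ of pairwise disjoint subsets $V_i\subseteq[n]$, each of cardinality $r$, such that each induced subgraph $\Gamma_{|V_i}$ is complete. *)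

theory Defs
  imports "HOL-Probability.Probability" "HOL-Library.Disjoint_Sets"
begin

text \<open>A simple graph is a pair of a vertex set and a set of edges, each edge being a
  two-element set of vertices.\<close>

type_synonym 'a sgraph = "'a set \<times> 'a set set"

abbreviation verts :: "'a sgraph \<Rightarrow> 'a set" where
  "verts G \<equiv> fst G"

abbreviation edges :: "'a sgraph \<Rightarrow> 'a set set" where
  "edges G \<equiv> snd G"

definition all_edges :: "'a set \<Rightarrow> 'a set set" where
  "all_edges V = {e. e \<subseteq> V \<and> card e = 2}"

definition induced_subgraph :: "'a sgraph \<Rightarrow> 'a set \<Rightarrow> 'a sgraph" where
  "induced_subgraph G V = (V, {e \<in> edges G. e \<subseteq> V})"

definition complete_graph :: "'a sgraph \<Rightarrow> bool" where
  "complete_graph G \<longleftrightarrow> edges G = all_edges (verts G)"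

text \<open>The size \<open>r\<close> is an integer because it will be the floor of a real number; there is
  no multi-clique (with \<open>s > 0\<close>) of negative size.\<close>

definition multi_clique :: "'a sgraph \<Rightarrow> nat \<Rightarrow> int \<Rightarrow> 'a set list \<Rightarrow> bool" where
  "multi_clique G s r Vs \<longleftrightarrow>
     length Vs = s \<and>
     disjoint_family_on (\<lambda>i. Vs ! i) {..<s} \<and>
     (\<forall>i<s. Vs ! i \<subseteq> verts G \<and> int (card (Vs ! i)) = r \<and>
            complete_graph (induced_subgraph G (Vs ! i)))"

text \<open>The family \<open>f\<close> of independent Bernoulli variables, indexed by the possible edges,
  selects the edges that are present.\<close>

definition erdos_renyi :: "nat \<Rightarrow> real \<Rightarrow> nat sgraph pmf" where
  "erdos_renyi n p =
     map_pmf (\<lambda>f. ({1..n}, {e \<in> all_edges {1..n}. f e}))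
       (Pi_pmf (all_edges {1..n}) False (\<lambda>_. bernoulli_pmf p))"

definition z_threshold :: "nat \<Rightarrow> real \<Rightarrow> real" where
  "z_threshold n p = (let q = 1 / p in
     2 * log q (real n) - 2 * log q (log q (real n)) + 2 * log q (exp 1 / 2) + 1)"

end

theory Submission
  imports Defs "HOL-Real_Asymp.Real_Asymp"
begin

text \<open>Let \<open>X\<close> be the number of \<open>r\<close>-cliques, \<open>\<mu>\<close> its mean, and \<open>Y\<close> the number of ordered pairs of
  intersecting \<open>r\<close>-cliques. If no \<open>s\<close> of the cliques are pairwise disjoint, then Turan's bound gives
  \<open>X\<^sup>2 \<le> (s - 1) Y\<close>, so that \<open>\<mu>\<^sup>2 / 2 \<le> (X - \<mu>)\<^sup>2 + (s - 1) Y\<close>. As disjoint cliques occur independently,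
  the variance of \<open>X\<close> is at most the mean of \<open>Y\<close>, and Markov's inequality bounds the probability of
  failure by \<open>2 s E[Y] / \<mu>\<^sup>2\<close>. This quotient is at most the sum over the overlap sizes \<open>1 \<le> i \<le> r\<close> of
  \<open>C(r,i)\<^sup>2 q^C(i,2) / C(n,i)\<close>. At \<open>r = \<lfloor>z - \<epsilon>\<rfloor>\<close> the terms with \<open>i \<le> r/2\<close> are nearly of order \<open>n\<^sup>-\<^sup>1\<^sup>/\<^sup>2\<close>, and
  those with \<open>i > r/2\<close> are \<open>O(r \<delta>\<^sup>r\<^sup>/\<^sup>2)\<close> with \<open>\<delta> = q\<^sup>-\<^sup>\<epsilon>\<^sup>/\<^sup>2\<close>.\<close>

section \<open>Turan's bound in terms of related pairs\<close>

text \<open>The sum counts ordered related pairs, the diagonal included, so its summands are closed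
  degrees in the graph of \<open>R\<close>. Turan's theorem bounds the independence number from
  below by \<open>card F\<close> over the average closed degree; the last hypothesis bounds it from
  above by \<open>s\<close>.\<close>

lemma turan_pairs:
  fixes F :: "'a set"
  assumes "finite F"
    and "\<And>x. x \<in> F \<Longrightarrow> R x x" and "\<And>x y. R x y \<Longrightarrow> R y x"
    and "\<And>S. S \<subseteq> F \<Longrightarrow> card S = Suc s \<Longrightarrow> \<exists>x\<in>S. \<exists>y\<in>S. x \<noteq> y \<and> R x y"
  shows "(card F)\<^sup>2 \<le> s * (\<Sum>x\<in>F. card {y\<in>F. R x y})"
  using assms
proof (induction s arbitrary: F)
  case 0
  have "F = {}"
  proof (rule ccontr)
    assume "F \<noteq> {}"
    then obtain x where "x \<in> F" by blast
    with "0.prems"(4)[of "{x}"] show False by auto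
  qed
  then show ?case by simp
next
  case (Suc s)
  show ?case
  proof (cases "F = {}")
    case False
    \<comment> \<open>Induct by deleting the closed neighbourhood of a point of least degree.\<close>
    define d where "d x = card {y\<in>F. R x y}" for x
    obtain a where a: "a \<in> F" "\<And>x. x \<in> F \<Longrightarrow> d a \<le> d x"
      using ex_min_if_finite[of "d ` F"] False \<open>finite F\<close> by (metis (mono_tags, lifting) arg_min_if_finite(1) arg_min_least)
    define N where "N = {y\<in>F. R a y}"
    define F' where "F' = {y\<in>F. \<not> R a y}"
    define Y' where "Y' = (\<Sum>x\<in>F'. card {y\<in>F'. R x y})"
    have fin: "finite N" "finite F'" using \<open>finite F\<close> by (auto simp: N_def F'_def)
    have split: "F = N \<union> F'" "N \<inter> F' = {}" by (auto simp: N_def F'_def)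
    have "(card F')\<^sup>2 \<le> s * Y'"
      unfolding Y'_def
    proof (rule Suc.IH)
      \<comment> \<open>No point of \<open>F'\<close> is related to \<open>a\<close>, so the related
        pair found in \<open>insert a S\<close> lies in \<open>S\<close>.\<close>
      fix S assume S: "S \<subseteq> F'" "card S = Suc s"
      have "a \<notin> S" using S(1) Suc.prems(2)[OF a(1)] by (auto simp: F'_def)
      moreover have "finite S" using S(1) fin(2) finite_subset by blast
      ultimately have "card (insert a S) = Suc (Suc s)" using S(2) by simp
      moreover have "insert a S \<subseteq> F" using S(1) a(1) by (auto simp: F'_def)
      ultimately obtain x y where "x \<in> insert a S" "y \<in> insert a S" "x \<noteq> y" "R x y"
        using Suc.prems(4) by blast
      with S(1) Suc.prems(3) show "\<exists>x\<in>S. \<exists>y\<in>S. x \<noteq> y \<and> R x y"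
        by (fastforce simp: F'_def)
    qed (use Suc.prems fin in \<open>auto simp: F'_def\<close>)
    \<comment> \<open>Related pairs starting in \<open>F'\<close> number at least \<open>Y'\<close>.
      Those starting in \<open>N\<close> number at least \<open>d a * d a\<close>, because
      \<open>N\<close> has \<open>d a\<close> points, each of degree at least
      \<open>d a\<close>.\<close>
    moreover have "Y' + d a * d a \<le> (\<Sum>x\<in>F. d x)"
    proof -
      have "Y' \<le> (\<Sum>x\<in>F'. d x)"
        unfolding Y'_def d_def by (intro sum_mono card_mono) (use \<open>finite F\<close> in \<open>auto simp: F'_def\<close>)
      moreover have "d a * d a \<le> (\<Sum>x\<in>N. d x)"
        using sum_bounded_below[of N "d a" d] a by (auto simp: N_def d_def)
      ultimately show ?thesis
        by (simp add: split sum.union_disjoint fin)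
    qed
    moreover have "card F = card F' + d a"
    proof -
      have "card F = card N + card F'" using card_Un_disjoint[OF fin split(2)] split(1) by metis
      then show ?thesis by (simp add: N_def d_def)
    qed
    ultimately have *: "(real (card F'))\<^sup>2 \<le> real s * real Y'"
        "real Y' + (real (d a))\<^sup>2 \<le> real (\<Sum>x\<in>F. d x)" "real (card F) = real (card F') + real (d a)"
      unfolding power2_eq_square of_nat_mult[symmetric] of_nat_add[symmetric] of_nat_le_iff by simp_all
    \<comment> \<open>With \<open>f = card F'\<close> and \<open>d = d a\<close>, this is what
      \<open>(f + d)^2 <= (s + 1) (Y' + d^2)\<close> needs beyond \<open>f^2 <= s Y'\<close>.
      Multiplied by \<open>s\<close> it follows from \<open>2 f (s d) <= f^2 + (s d)^2\<close>; for
      \<open>s = 0\<close> the bound on \<open>f^2\<close> gives \<open>f = 0\<close>.\<close>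
    have "2 * real (card F') * real (d a) \<le> real Y' + real s * (real (d a))\<^sup>2"
    proof (cases "s = 0")
      case True
      with * show ?thesis by simp
    next
      case False
      have "real s * (2 * real (card F') * real (d a)) \<le> (real (card F'))\<^sup>2 + (real s * real (d a))\<^sup>2"
        using sum_squares_bound[of "real (card F')" "real s * real (d a)"] by (simp add: algebra_simps)
      also have "\<dots> \<le> real s * (real Y' + real s * (real (d a))\<^sup>2)"
        using *(1) by (simp add: algebra_simps power2_eq_square)
      finally show ?thesis using False by simp
    qed
    with *(1) have "(real (card F' + d a))\<^sup>2 \<le> (real s + 1) * (real Y' + (real (d a))\<^sup>2)"
      by (simp add: power2_sum algebra_simps)
    also have "\<dots> \<le> (real s + 1) * real (\<Sum>x\<in>F. d x)"
      using *(2) by (intro mult_left_mono) auto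
    finally have "(real (card F))\<^sup>2 \<le> (real s + 1) * real (\<Sum>x\<in>F. d x)" using *(3) by simp
    then have "real ((card F)\<^sup>2) \<le> real (Suc s * (\<Sum>x\<in>F. d x))" 
      by (simp add: algebra_simps)
    then show ?thesis unfolding d_def by (simp only: of_nat_le_iff)
  qed simp
qed

section \<open>The second moment argument\<close>

text \<open>\<open>R\<close> stands for possible dependence: unrelated events are not positively
  correlated, so only related pairs can raise the variance of the number of events that occur. The
  quotient controls both ways of missing \<open>G\<close>: too few events occur, or those that occur
  are too heavily related.\<close>

lemma (in prob_space) prob_independent_subfamily:
  assumes "finite K" and E: "\<And>A. A \<in> K \<Longrightarrow> E A \<in> events"
    and R_refl: "\<And>A. A \<in> K \<Longrightarrow> R A A" and R_sym: "\<And>A B. R A B \<Longrightarrow> R B A"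
    and indep: "\<And>A B. A \<in> K \<Longrightarrow> B \<in> K \<Longrightarrow> \<not> R A B \<Longrightarrow> prob (E A \<inter> E B) \<le> prob (E A) * prob (E B)"
    and G: "G \<in> events"
      "\<And>x S. x \<in> space M \<Longrightarrow> S \<subseteq> K \<Longrightarrow> card S = Suc s \<Longrightarrow> pairwise (\<lambda>A B. \<not> R A B) S \<Longrightarrow>
        \<forall>A\<in>S. x \<in> E A \<Longrightarrow> x \<in> G"
    and pos: "(\<Sum>A\<in>K. prob (E A)) > 0"
  shows "prob G \<ge> 1 - 2 * real (Suc s) * (\<Sum>A\<in>K. \<Sum>B | B \<in> K \<and> R A B. prob (E A \<inter> E B)) / (\<Sum>A\<in>K. prob (E A))\<^sup>2"
proof -
  define \<mu> where "\<mu> = (\<Sum>A\<in>K. prob (E A))"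
  define D where "D = (\<Sum>A\<in>K. \<Sum>B | B \<in> K \<and> R A B. prob (E A \<inter> E B))"
  define X :: "'a \<Rightarrow> real" where "X x = (\<Sum>A\<in>K. indicator (E A) x)" for x
  define Y :: "'a \<Rightarrow> real" where "Y x = (\<Sum>A\<in>K. \<Sum>B | B \<in> K \<and> R A B. indicator (E A \<inter> E B) x)" for x
  \<comment> \<open>One variable covers both a large deviation of \<open>X\<close> and a large
    number \<open>Y\<close> of related pairs, so that a single use of Markov's inequality
    suffices.\<close>
  define U where "U x = (X x - \<mu>)\<^sup>2 + real s * Y x" for x
  note [measurable] = E G(1)
  have EE[measurable]: "E A \<inter> E B \<in> events" if "A \<in> K" "B \<in> K" for A B using that E by auto
  have X2: "(X x)\<^sup>2 = (\<Sum>A\<in>K. \<Sum>B\<in>K. indicator (E A \<inter> E B) x)" for x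
    by (simp add: X_def power2_eq_square sum_product indicator_inter_arith)
  have U_eq: "U x = (\<Sum>A\<in>K. \<Sum>B\<in>K. indicator (E A \<inter> E B) x) - 2 * \<mu> * (\<Sum>A\<in>K. indicator (E A) x) + \<mu>\<^sup>2 + real s * Y x" for x
    unfolding U_def power2_diff X2 by (simp add: X_def)
  have int: "integrable M (\<lambda>x. indicator (E A \<inter> E B) x :: real)" if "A \<in> K" "B \<in> K" for A B
    using that by (intro integrable_real_indicator) (auto simp: emeasure_eq_measure)
  have int1: "integrable M (\<lambda>x. indicator (E A) x :: real)" if "A \<in> K" for A
    using that by (intro integrable_real_indicator) (auto simp: emeasure_eq_measure)
  have intY: "integrable M Y" unfolding Y_def
    by (intro Bochner_Integration.integrable_sum int) auto
  have EEsum: "expectation (\<lambda>x. \<Sum>A\<in>K. \<Sum>B\<in>S A. indicator (E A \<inter> E B) x) = (\<Sum>A\<in>K. \<Sum>B\<in>S A. prob (E A \<inter> E B))"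
    if S: "\<And>A. A \<in> K \<Longrightarrow> S A \<subseteq> K" for S
  proof -
    have i: "integrable M (\<lambda>x. indicator (E A \<inter> E B) x :: real)" if "A \<in> K" "B \<in> S A" for A B
      using S that by (intro int) auto
    have "expectation (\<lambda>x. \<Sum>A\<in>K. \<Sum>B\<in>S A. indicator (E A \<inter> E B) x :: real) =
        (\<Sum>A\<in>K. expectation (\<lambda>x. \<Sum>B\<in>S A. indicator (E A \<inter> E B) x))"
      by (intro Bochner_Integration.integral_sum Bochner_Integration.integrable_sum i)
    also have "\<dots> = (\<Sum>A\<in>K. \<Sum>B\<in>S A. expectation (\<lambda>x. indicator (E A \<inter> E B) x))"
      by (rule sum.cong[OF refl], rule Bochner_Integration.integral_sum, rule i)
    also have "\<dots> = (\<Sum>A\<in>K. \<Sum>B\<in>S A. prob (E A \<inter> E B))"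
    proof (intro sum.cong refl)
      fix A B assume "A \<in> K" "B \<in> S A"
      with S have "E A \<inter> E B \<in> events" by (intro EE) auto
      then show "expectation (\<lambda>x. indicator (E A \<inter> E B) x) = prob (E A \<inter> E B)" by simp
    qed
    finally show ?thesis .
  qed
  have EY: "expectation Y = D" unfolding Y_def D_def by (rule EEsum) auto
  have E2: "expectation (\<lambda>x. \<Sum>A\<in>K. \<Sum>B\<in>K. indicator (E A \<inter> E B) x) = (\<Sum>A\<in>K. \<Sum>B\<in>K. prob (E A \<inter> E B))"
    by (rule EEsum) auto
  have E1: "expectation (\<lambda>x. \<Sum>A\<in>K. indicator (E A) x) = \<mu>"
    unfolding \<mu>_def by (subst Bochner_Integration.integral_sum) (auto intro!: int1)
  have intU: "integrable M U"
    unfolding U_eq[abs_def] 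
    by (intro Bochner_Integration.integrable_add Bochner_Integration.integrable_diff
        integrable_mult_right Bochner_Integration.integrable_sum int int1 intY) auto
  have "expectation U = (\<Sum>A\<in>K. \<Sum>B\<in>K. prob (E A \<inter> E B)) - 2 * \<mu> * \<mu> + \<mu>\<^sup>2 + real s * D"
  proof -
    have i2: "integrable M (\<lambda>x. \<Sum>A\<in>K. \<Sum>B\<in>K. indicator (E A \<inter> E B) x :: real)"
      by (intro Bochner_Integration.integrable_sum int)
    have i1: "integrable M (\<lambda>x. \<Sum>A\<in>K. indicator (E A) x :: real)"
      by (intro Bochner_Integration.integrable_sum int1)
    show ?thesis
      unfolding U_eq[abs_def] using i1 i2 intY by (simp add: E1 E2 EY prob_space)
  qed
  \<comment> \<open>For unrelated pairs the product of probabilities is the bound. Adding it for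
    related pairs too only weakens the estimate and completes the products to
    \<open>\<mu>\<^sup>2\<close>.\<close>
  also have "(\<Sum>A\<in>K. \<Sum>B\<in>K. prob (E A \<inter> E B)) \<le> D + \<mu>\<^sup>2"
  proof -
    have "(\<Sum>B\<in>K. prob (E A \<inter> E B)) \<le> (\<Sum>B | B \<in> K \<and> R A B. prob (E A \<inter> E B)) + (\<Sum>B\<in>K. prob (E A) * prob (E B))"
      if "A \<in> K" for A
    proof -
      have "(\<Sum>B\<in>K. prob (E A \<inter> E B)) \<le>
          (\<Sum>B\<in>K. (if R A B then prob (E A \<inter> E B) else 0) + prob (E A) * prob (E B))"
        by (intro sum_mono) (use that indep in \<open>auto simp: add_increasing2\<close>)
      also have "\<dots> = (\<Sum>B\<in>K. (if R A B then prob (E A \<inter> E B) else 0)) + (\<Sum>B\<in>K. prob (E A) * prob (E B))"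
        by (simp add: sum.distrib)
      also have "(\<Sum>B\<in>K. (if R A B then prob (E A \<inter> E B) else 0)) = (\<Sum>B | B \<in> K \<and> R A B. prob (E A \<inter> E B))"
        using \<open>finite K\<close> by (intro sum.inter_filter[symmetric])
      finally show ?thesis .
    qed
    then have "(\<Sum>A\<in>K. \<Sum>B\<in>K. prob (E A \<inter> E B)) \<le> 
       (\<Sum>A\<in>K. (\<Sum>B | B \<in> K \<and> R A B. prob (E A \<inter> E B)) + (\<Sum>B\<in>K. prob (E A) * prob (E B)))"
      by (intro sum_mono)
    then show ?thesis
      by (simp add: sum.distrib D_def \<mu>_def power2_eq_square sum_product)
  qed
  \<comment> \<open>One \<open>D\<close> bounds the variance, and \<open>s\<close> more come from
    the multiple of \<open>Y\<close> in \<open>U\<close>.\<close>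
  finally have EU: "expectation U \<le> real (Suc s) * D" 
    by (simp add: power2_eq_square algebra_simps)
  have bad: "\<mu>\<^sup>2 / 2 \<le> U x" if x: "x \<in> space M" "x \<notin> G" for x
  proof -
    define F where "F = {A\<in>K. x \<in> E A}"
    have "finite F" using \<open>finite K\<close> by (simp add: F_def)
    have cX: "X x = card F"
      using \<open>finite K\<close> by (simp add: X_def F_def indicator_def sum.If_cases Int_def)
    have "Y x = (\<Sum>A\<in>K. if x \<in> E A then (\<Sum>B | B \<in> K \<and> R A B. indicator (E B) x) else 0)"
      unfolding Y_def by (intro sum.cong) (auto simp: indicator_def)
    also have "\<dots> = (\<Sum>A\<in>F. \<Sum>B | B \<in> K \<and> R A B. indicator (E B) x)"
      unfolding F_def using \<open>finite K\<close> by (rule sum.inter_filter[symmetric])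
    also have "\<dots> = (\<Sum>A\<in>F. real (card {B\<in>F. R A B}))"
    proof (intro sum.cong refl)
      fix A
      have "(\<Sum>B | B \<in> K \<and> R A B. indicator (E B) x) = real (card ({B. B \<in> K \<and> R A B} \<inter> {B. x \<in> E B}))"
        using \<open>finite K\<close> by (simp add: indicator_def sum.If_cases)
      also have "{B. B \<in> K \<and> R A B} \<inter> {B. x \<in> E B} = {B\<in>F. R A B}" by (auto simp: F_def)
      finally show "(\<Sum>B | B \<in> K \<and> R A B. indicator (E B) x) = real (card {B\<in>F. R A B})" .
    qed
    finally have cY: "Y x = (\<Sum>A\<in>F. real (card {B\<in>F. R A B}))" .
    have "(card F)\<^sup>2 \<le> s * (\<Sum>A\<in>F. card {B\<in>F. R A B})"
    proof (rule turan_pairs)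
      fix S assume S: "S \<subseteq> F" "card S = Suc s"
      show "\<exists>A\<in>S. \<exists>B\<in>S. A \<noteq> B \<and> R A B"
      proof (rule ccontr)
        assume "\<not> ?thesis"
        then have "pairwise (\<lambda>A B. \<not> R A B) S" by (auto simp: pairwise_def)
        with G(2)[OF x(1), of S] S x(2) show False by (auto simp: F_def)
      qed
    qed (use \<open>finite F\<close> R_refl R_sym in \<open>auto simp: F_def\<close>)
    then have "real ((card F)\<^sup>2) \<le> real (s * (\<Sum>A\<in>F. card {B\<in>F. R A B}))"
      by (simp only: of_nat_le_iff)
    then have "(X x)\<^sup>2 \<le> real s * Y x" by (simp add: cX cY)
    \<comment> \<open>The difference of the two sides is
      \<open>(2 * X x - \<mu>)\<^sup>2\<close>.\<close>
    moreover have "\<mu>\<^sup>2 \<le> 2 * (X x - \<mu>)\<^sup>2 + 2 * (X x)\<^sup>2"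
      using zero_le_power2[of "2 * X x - \<mu>"] by (simp add: power2_eq_square algebra_simps)
    ultimately show ?thesis by (simp add: U_def)
  qed
  have "Y x \<ge> 0" for x unfolding Y_def by (intro sum_nonneg) auto
  then have Upos: "U x \<ge> 0" for x by (simp add: U_def)
  have "prob (space M - G) \<le> prob {x\<in>space M. \<mu>\<^sup>2 / 2 \<le> U x}"
    using bad intU by (intro finite_measure_mono) auto
  also have "\<dots> \<le> expectation U / (\<mu>\<^sup>2 / 2)"
    using pos Upos by (intro integral_Markov_inequality_measure[where A = "{}"] intU) (auto simp: \<mu>_def)
  also have "\<dots> \<le> real (Suc s) * D / (\<mu>\<^sup>2 / 2)"
    by (intro divide_right_mono EU) auto
  finally show ?thesis
    using prob_compl[OF G(1)] by (simp add: D_def \<mu>_def algebra_simps)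
qed

section \<open>Edge sets, clique probabilities and multi-cliques\<close>

lemma card_all_edges:
  assumes "finite V"
  shows "card (all_edges V) = card V choose 2"
  unfolding all_edges_def using n_subsets[OF assms] by simp

lemma finite_all_edges [simp]: "finite V \<Longrightarrow> finite (all_edges V)"
  by (rule finite_subset[of _ "Pow V"]) (auto simp: all_edges_def)

lemma all_edges_mono: "A \<subseteq> B \<Longrightarrow> all_edges A \<subseteq> all_edges B"
  by (auto simp: all_edges_def)

lemma all_edges_Int: "all_edges A \<inter> all_edges B = all_edges (A \<inter> B)"
  by (auto simp: all_edges_def)

lemma prob_all_present:
  assumes "finite A" "S \<subseteq> A" "0 \<le> p" "p \<le> 1"
  shows "measure_pmf.prob (Pi_pmf A False (\<lambda>_. bernoulli_pmf p)) {f. \<forall>e\<in>S. f e} = p ^ card S"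
proof -
  \<comment> \<open>Edges outside \<open>S\<close> carry the trivial constraint \<open>UNIV\<close>,
    which turns the event into a box of the product measure.\<close>
  have "measure_pmf.prob (Pi_pmf A False (\<lambda>_. bernoulli_pmf p)) {f. \<forall>e\<in>S. f e} =
      measure_pmf.prob (Pi_pmf A False (\<lambda>_. bernoulli_pmf p)) (Pi A (\<lambda>e. if e \<in> S then {True} else UNIV))"
    using assms(2) by (intro arg_cong[where f = "measure_pmf.prob _"]) (auto simp: Pi_def split: if_splits)
  also have "\<dots> = (\<Prod>e\<in>A. if e \<in> S then p else 1)"
    using assms by (subst measure_Pi_pmf_Pi) (auto intro!: prod.cong simp: measure_pmf_single)
  also have "\<dots> = p ^ card S"
    using assms by (simp add: prod.If_cases Int_absorb1 Int_commute)
  finally show ?thesis .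
qed

lemma complete_induced_subgraph_iff:
  assumes "V \<subseteq> U"
  shows "complete_graph (induced_subgraph (U, {e \<in> all_edges U. f e}) V) \<longleftrightarrow> (\<forall>e\<in>all_edges V. f e)"
  using assms by (auto simp: complete_graph_def induced_subgraph_def all_edges_def)

lemma multi_clique_of_disjoint_cliques:
  assumes "card S = s" "s > 0" "pairwise disjnt S"
    and "\<And>A. A \<in> S \<Longrightarrow> A \<subseteq> U \<and> card A = r \<and> (\<forall>e\<in>all_edges A. f e)"
  shows "\<exists>Vs. multi_clique (U, {e \<in> all_edges U. f e}) s (int r) Vs"
proof -
  \<comment> \<open>An infinite set has \<open>card\<close> 0, so \<open>s > 0\<close> forces
    \<open>S\<close> to be finite.\<close>
  have "finite S" using assms(1,2) card_ge_0_finite by blast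
  then obtain Vs where Vs: "set Vs = S" "distinct Vs"
    using finite_distinct_list by blast
  then have len: "length Vs = s" using assms(1) distinct_card by fastforce
  have "disjoint_family_on (\<lambda>i. Vs ! i) {..<s}"
    unfolding disjoint_family_on_def
  proof (intro ballI impI)
    fix i j assume "i \<in> {..<s}" "j \<in> {..<s}" "i \<noteq> j"
    with Vs len have "Vs ! i \<noteq> Vs ! j" "Vs ! i \<in> S" "Vs ! j \<in> S"
      by (auto simp: nth_eq_iff_index_eq)
    with assms(3) show "Vs ! i \<inter> Vs ! j = {}" by (auto simp: pairwise_def disjnt_def)
  qed
  moreover have "Vs ! i \<in> S" if "i < s" for i using that Vs len by auto
  ultimately have "multi_clique (U, {e \<in> all_edges U. f e}) s (int r) Vs"
    unfolding multi_clique_def using assms(4) len by (force simp: complete_induced_subgraph_iff)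
  then show ?thesis ..
qed

section \<open>Counting intersecting pairs of cliques\<close>

lemma card_supersets:
  assumes "finite U" "I \<subseteq> U" "card I \<le> r"
  shows "card {B. I \<subseteq> B \<and> B \<subseteq> U \<and> card B = r} = (card U - card I) choose (r - card I)"
proof -
  have fI: "finite I" using assms finite_subset by blast
  have "bij_betw (\<lambda>B. B - I) {B. I \<subseteq> B \<and> B \<subseteq> U \<and> card B = r} {C. C \<subseteq> U - I \<and> card C = r - card I}"
  proof (rule bij_betw_byWitness[where f' = "\<lambda>C. C \<union> I"])
    show "(\<lambda>C. C \<union> I) ` {C. C \<subseteq> U - I \<and> card C = r - card I} \<subseteq> {B. I \<subseteq> B \<and> B \<subseteq> U \<and> card B = r}"
    proof safe
      fix C assume C: "C \<subseteq> U - I" "card C = r - card I"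
      then have "finite C" using assms(1) finite_subset by blast
      then have "card (C \<union> I) = card C + card I"
        using C fI by (intro card_Un_disjoint) auto
      then show "card (C \<union> I) = r" using C assms(3) by simp
    qed (use assms in auto)
  qed (use fI in \<open>auto simp: card_Diff_subset\<close>)
  then have "card {B. I \<subseteq> B \<and> B \<subseteq> U \<and> card B = r} = card {C. C \<subseteq> U - I \<and> card C = r - card I}"
    by (rule bij_betw_same_card)
  also have "\<dots> = card (U - I) choose (r - card I)"
    using assms(1) by (intro n_subsets) auto
  finally show ?thesis using assms fI by (simp add: card_Diff_subset)
qed

text \<open>The \<open>i\<close>-th term comes from the \<open>C(n,r) C(r,i) C(n-i,r-i)\<close>
  triples \<open>(A, B, I)\<close> with \<open>I\<close> an \<open>i\<close>-subset of both
  \<open>r\<close>-sets \<open>A\<close> and \<open>B\<close>. Each is weighted by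
  \<open>p ^ -C(i,2)\<close>, the gain over independence when exactly \<open>I\<close> is shared,
  and the total is divided by \<open>C(n,r)^2\<close>.\<close>

definition overlap_sum :: "nat \<Rightarrow> nat \<Rightarrow> real \<Rightarrow> real" where
  "overlap_sum n r p = (\<Sum>i=1..r. (real (r choose i))\<^sup>2 / (real (n choose i) * p ^ (i choose 2)))"

text \<open>Counting pairs \<open>A\<close>, \<open>B\<close> with a marked common subset
  \<open>I\<close> overcounts, but the number of \<open>B\<close> containing \<open>I\<close> is
  \<open>C(n-i,r-i)\<close>. Unlike the exact count for \<open>A \<inter> B = I\<close>, this
  combines with \<open>C(n,r)\<close> through
  \<open>C(n,r) C(r,i) = C(n,i) C(n-i,r-i)\<close>.\<close>

lemma clique_overlap_bound:
  fixes p :: real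
  assumes p: "0 < p" "p \<le> 1" and rn: "1 \<le> r" "r \<le> n"
  defines "K \<equiv> {A. A \<subseteq> {1..n} \<and> card A = r}"
  shows "(\<Sum>A\<in>K. \<Sum>B | B \<in> K \<and> \<not> disjnt A B. p ^ card (all_edges A \<union> all_edges B))
    \<le> (real (n choose r) * p ^ (r choose 2))\<^sup>2 * overlap_sum n r p"
proof -
  have finK: "finite K" by (rule finite_subset[of _ "Pow {1..n}"]) (auto simp: K_def)
  have cardK: "card K = n choose r" using n_subsets[of "{1..n}" r] by (simp add: K_def)
  have fin: "finite A" if "A \<in> K" for A using that finite_subset unfolding K_def by blast
  \<comment> \<open>\<open>g i\<close> is the probability that two \<open>r\<close>-sets sharing
    \<open>i\<close> vertices are both cliques; the quotient avoids subtracting natural numbers in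
    the exponent.\<close>
  define g where "g i = p ^ (2 * (r choose 2)) / p ^ (i choose 2)" for i
  have gpos: "g i \<ge> 0" for i using p by (simp add: g_def)
  have key: "(\<Sum>B | B \<in> K \<and> \<not> disjnt A B. p ^ card (all_edges A \<union> all_edges B))
     \<le> (\<Sum>i=1..r. real (r choose i) * (g i * real ((n - i) choose (r - i))))" if A: "A \<in> K" for A
  proof -
    have cA: "card A = r" "finite A" "A \<subseteq> {1..n}" using A fin[OF A] by (auto simp: K_def)
    \<comment> \<open>Replace the overlap \<open>A \<inter> B\<close> by a sum over all nonempty \<open>I \<subseteq> A\<close> contained in \<open>B\<close>.\<close>
    define P where "P = {I. I \<subseteq> A \<and> I \<noteq> {}}"
    have finP: "finite P" using cA by (simp add: P_def)
    have eq: "p ^ card (all_edges A \<union> all_edges B) = g (card (A \<inter> B))" if "B \<in> K" for B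
    proof -
      have "card (all_edges A \<union> all_edges B) + card (all_edges (A \<inter> B)) = 2 * (r choose 2)"
        using card_Un_Int[of "all_edges A" "all_edges B"] that cA fin[OF that]
        by (simp add: all_edges_Int card_all_edges K_def)
      then have "card (all_edges A \<union> all_edges B) + (card (A \<inter> B) choose 2) = 2 * (r choose 2)"
        using cA by (simp add: card_all_edges)
      then show ?thesis using p by (simp add: g_def field_simps flip: power_add)
    qed
    have "(\<Sum>B | B \<in> K \<and> \<not> disjnt A B. p ^ card (all_edges A \<union> all_edges B)) =
        (\<Sum>B | B \<in> K \<and> \<not> disjnt A B. g (card (A \<inter> B)))"
      by (intro sum.cong) (auto simp: eq)
    also have "\<dots> \<le> (\<Sum>B\<in>K. \<Sum>I\<in>P. if I \<subseteq> B then g (card I) else 0)"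
    proof -
      have "(\<Sum>B | B \<in> K \<and> \<not> disjnt A B. g (card (A \<inter> B))) \<le>
          (\<Sum>B | B \<in> K \<and> \<not> disjnt A B. \<Sum>I\<in>P. if I \<subseteq> B then g (card I) else 0)"
      proof (rule sum_mono)
        fix B assume "B \<in> {B. B \<in> K \<and> \<not> disjnt A B}"
        then have "A \<inter> B \<in> P" by (auto simp: P_def disjnt_def)
        from member_le_sum[OF this _ finP, of "\<lambda>I. if I \<subseteq> B then g (card I) else 0"]
        show "g (card (A \<inter> B)) \<le> (\<Sum>I\<in>P. if I \<subseteq> B then g (card I) else 0)"
          using gpos by simp
      qed
      also have "\<dots> \<le> (\<Sum>B\<in>K. \<Sum>I\<in>P. if I \<subseteq> B then g (card I) else 0)"
        using gpos finK by (intro sum_mono2) (auto intro!: sum_nonneg)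
      finally show ?thesis .
    qed
    also have "\<dots> = (\<Sum>I\<in>P. \<Sum>B\<in>K. if I \<subseteq> B then g (card I) else 0)"
      by (rule sum.swap)
    also have "\<dots> = (\<Sum>I\<in>P. g (card I) * real ((n - card I) choose (r - card I)))"
    proof (rule sum.cong[OF refl])
      fix I assume I: "I \<in> P"
      then have cI: "I \<subseteq> {1..n}" "card I \<le> r" using cA card_mono[of A I] by (auto simp: P_def)
      have "(\<Sum>B\<in>K. if I \<subseteq> B then g (card I) else 0) = g (card I) * real (card {B\<in>K. I \<subseteq> B})"
        using finK by (simp add: sum.If_cases Int_def)
      also have "{B\<in>K. I \<subseteq> B} = {B. I \<subseteq> B \<and> B \<subseteq> {1..n} \<and> card B = r}" by (auto simp: K_def)
      also have "card \<dots> = (n - card I) choose (r - card I)"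
        using card_supersets[of "{1..n}" I r] cI by simp
      finally show "(\<Sum>B\<in>K. if I \<subseteq> B then g (card I) else 0) = g (card I) * real ((n - card I) choose (r - card I))" .
    qed
    also have "\<dots> = (\<Sum>i=1..r. \<Sum>I | I \<in> P \<and> card I = i. g (card I) * real ((n - card I) choose (r - card I)))"
    proof (rule sum.group[symmetric])
      show "card ` P \<subseteq> {1..r}"
        using cA card_mono[of A] finite_subset[of _ A] by (auto simp: P_def Suc_le_eq card_gt_0_iff)
    qed (use finP in auto)
    also have "\<dots> = (\<Sum>i=1..r. real (r choose i) * (g i * real ((n - i) choose (r - i))))"
    proof (rule sum.cong[OF refl])
      fix i assume i: "i \<in> {1..r}"
      have "{I. I \<in> P \<and> card I = i} = {I. I \<subseteq> A \<and> card I = i}" using i by (auto simp: P_def)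
      then have "card {I. I \<in> P \<and> card I = i} = r choose i"
        using n_subsets[of A i] cA by simp
      then show "(\<Sum>I | I \<in> P \<and> card I = i. g (card I) * real ((n - card I) choose (r - card I))) =
          real (r choose i) * (g i * real ((n - i) choose (r - i)))" by simp
    qed
    finally show ?thesis .
  qed
  have "(\<Sum>A\<in>K. \<Sum>B | B \<in> K \<and> \<not> disjnt A B. p ^ card (all_edges A \<union> all_edges B))
     \<le> real (n choose r) * (\<Sum>i=1..r. real (r choose i) * (g i * real ((n - i) choose (r - i))))"
    unfolding cardK[symmetric] by (rule sum_bounded_above) (rule key)
  also have "\<dots> = (real (n choose r) * p ^ (r choose 2))\<^sup>2 * overlap_sum n r p"
    unfolding overlap_sum_def sum_distrib_left
  proof (rule sum.cong[OF refl])
    fix i assume i: "i \<in> {1..r}"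
    have "real (n choose r) * real (r choose i) = real (n choose i) * real ((n - i) choose (r - i))"
      using choose_mult[of i r n] i rn by (simp flip: of_nat_mult)
    moreover have "real (n choose i) > 0" using i rn by simp
    ultimately have "real ((n - i) choose (r - i)) = real (n choose r) * real (r choose i) / real (n choose i)"
      by (simp add: field_simps)
    then show "real (n choose r) * (real (r choose i) * (g i * real ((n - i) choose (r - i)))) =
      (real (n choose r) * p ^ (r choose 2))\<^sup>2 * ((real (r choose i))\<^sup>2 / (real (n choose i) * p ^ (i choose 2)))"
      by (simp add: g_def power2_eq_square mult_2 power_add mult_ac)
  qed
  finally show ?thesis .
qed

section \<open>Elementary estimates and the bound on the overlap sum\<close>

text \<open>The induction step is \<open>(1 - 1 / (i + 1)) ^ (i + 1) <= 1 / e\<close>. A factor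
  polynomial in \<open>i\<close> is harmless later, but the base \<open>i / e\<close> has to be
  sharp: it accounts for the \<open>e\<close> in \<open>z\<close>.\<close>

lemma fact_le_exp_power:
  assumes "i \<ge> 1"
  shows "fact i \<le> exp 1 * real i * (real i / exp 1) ^ i"
  using assms
proof (induction i rule: dec_induct)
  case (step i)
  have "(1 - 1 / real (Suc i)) ^ Suc i \<le> exp (- (1 / real (Suc i))) ^ Suc i"
    using exp_ge_add_one_self[of "- (1 / real (Suc i))"] by (intro power_mono) auto
  also have "\<dots> = exp (-1)"
    by (simp del: power_Suc of_nat_Suc flip: exp_of_nat_mult)
  finally have "(real i / real (Suc i)) ^ Suc i \<le> exp (-1)"
    by (simp add: field_simps)
  then have *: "exp 1 * real i ^ Suc i \<le> real (Suc i) ^ Suc i"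
    by (simp add: power_divide exp_minus field_simps del: power_Suc of_nat_Suc)
  have "fact (Suc i) \<le> real (Suc i) * (exp 1 * real i * (real i / exp 1) ^ i)"
    using step.IH by (simp del: of_nat_Suc)
  also have "\<dots> = real (Suc i) * exp 1 * (exp 1 * real i ^ Suc i) / exp 1 ^ Suc i"
    by (simp add: power_divide field_simps del: of_nat_Suc)
  also have "\<dots> \<le> real (Suc i) * exp 1 * (real (Suc i) ^ Suc i) / exp 1 ^ Suc i"
    by (intro divide_right_mono mult_left_mono *) auto
  finally show ?case by (simp add: power_divide mult_ac del: of_nat_Suc power_Suc)
qed auto

text \<open>\<open>fact i * (n choose i)\<close> is the falling factorial
  \<open>n (n - 1) ... (n - i + 1)\<close>, and each of its \<open>i\<close> factors is at least
  \<open>n - r\<close>.\<close>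

lemma fact_times_binomial_ge:
  assumes "i \<le> r" "r \<le> n"
  shows "real (n - r) ^ i \<le> fact i * real (n choose i)"
  using assms(1)
proof (induction i)
  case (Suc i)
  obtain b where n: "n = Suc (i + b)" using Suc.prems assms(2) less_imp_Suc_add[of i n] by auto
  have "fact (Suc i) * real (n choose Suc i) = fact i * real (Suc i * (n choose Suc i))"
    by (simp add: algebra_simps)
  also have "Suc i * (n choose Suc i) = (n - i) * (n choose i)"
    unfolding n using Suc_times_binomial_add[of i b] by simp
  also have "fact i * real ((n - i) * (n choose i)) = real (n - i) * (fact i * real (n choose i))"
    by simp
  also have "\<dots> \<ge> real (n - r) * real (n - r) ^ i"
    using Suc by (intro mult_mono) auto
  finally show ?case by simp
qed simp

text \<open>Replacing the falling factorial by \<open>n ^ i\<close> costs a factor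
  \<open>(1 - r / n) ^ i\<close>. By Bernoulli's inequality it is at least
  \<open>1 - i r / n\<close>, which is at least 1/2 because
  \<open>i r <= r^2 <= n / 2\<close>.\<close>

lemma binomial_inverse_le:
  assumes "1 \<le> n" "2 * r\<^sup>2 \<le> n" "i \<le> r"
  shows "1 / real (n choose i) \<le> 2 * fact i / real n ^ i"
proof -
  have rn: "r \<le> n" using assms(2) by (simp add: power2_eq_square) (metis le_square le_trans mult_2 trans_le_add1)
  have n: "real n > 0" using assms(1) by simp
  have "real i * real r \<le> real r * real r"
    using assms(3) by (intro mult_right_mono) auto
  moreover have "real (2 * r\<^sup>2) \<le> real n" using assms(2) by (simp only: of_nat_le_iff)
  ultimately have ir: "2 * (real i * real r) \<le> real n" by (simp add: power2_eq_square)
  have "1 / 2 \<le> 1 + real i * (- (real r / real n))"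
    using n ir by (simp add: field_simps)
  also have "\<dots> \<le> (1 + - (real r / real n)) ^ i"
    using n rn by (intro Bernoulli_inequality) (auto simp: field_simps)
  also have "\<dots> = real (n - r) ^ i / real n ^ i"
    using n rn by (simp add: of_nat_diff power_divide[symmetric] diff_divide_distrib)
  also have "\<dots> \<le> fact i * real (n choose i) / real n ^ i"
    using fact_times_binomial_ge[OF assms(3) rn] by (intro divide_right_mono) auto
  finally show ?thesis
    using n assms(3) rn by (simp add: field_simps)
qed

text \<open>Writing \<open>C(i,2)\<close> as \<open>i (i - 1) / 2\<close> makes this factor an
  \<open>i\<close>-th power, which can be merged with the \<open>i\<close>-th powers from the
  factorial and binomial estimates.\<close>

lemma inverse_power_choose_two:
  fixes p :: real
  assumes "0 < p" "i \<ge> 1"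
  shows "1 / p ^ (i choose 2) = ((1 / p) powr ((real i - 1) / 2)) ^ i"
proof -
  have "real (i choose 2) = (real i - 1) / 2 * real i"
    using assms(2) by (simp add: choose_two real_of_nat_div of_nat_diff)
  moreover have "1 / p ^ (i choose 2) = (1 / p) powr real (i choose 2)"
    using assms(1) by (simp add: powr_realpow power_one_over)
  moreover have "((1 / p) powr ((real i - 1) / 2)) ^ i = (1 / p) powr ((real i - 1) / 2 * real i)"
    using assms(1) by (simp add: powr_powr flip: powr_realpow)
  ultimately show ?thesis by (simp only:)
qed

text \<open>The hypothesis \<open>critical\<close> is what \<open>r \<le> z - \<epsilon>\<close> amounts to, with \<open>\<delta> = q\<^sup>-\<^sup>\<epsilon>\<^sup>/\<^sup>2\<close>.\<close>

lemma overlap_sum_le: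
  fixes p \<delta> :: real and n r :: nat
  defines "q \<equiv> 1 / p"
  assumes p: "0 < p" "p < 1" and \<delta>: "0 < \<delta>" "\<delta> < 1" and n: "1 \<le> n" and r: "1 \<le> r" "2 * r\<^sup>2 \<le> n"
    and critical: "real r * q powr ((real r - 1) / 2) \<le> exp 1 * real n * \<delta>"
    and small: "(real r)\<^sup>2 * sqrt (3 * real n) / real n \<le> 1"
    and large: "(real r)\<^sup>2 \<le> q powr (real r / 4)"
  shows "overlap_sum n r p \<le>
    real r * (2 * ((real r)\<^sup>2 * sqrt (3 * real n) / real n) + 2 * exp 1 * real r * \<delta> powr (real r / 2))"
proof -
  have q: "q > 1" using p by (simp add: q_def)
  \<comment> \<open>\<open>v i ^ i\<close> is \<open>1 / p ^ (i choose 2)\<close>, and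
    \<open>w\<close> is \<open>v r\<close>, the quantity that \<open>critical\<close>
    controls.\<close>
  define w where "w = q powr ((real r - 1) / 2)"
  define v where "v i = q powr ((real i - 1) / 2)" for i :: nat
  have vpos: "v i > 0" for i using q by (simp add: v_def)
  have npos: "real n > 0" using n by simp
  have T_le: "(real (r choose i))\<^sup>2 / (real (n choose i) * p ^ (i choose 2)) \<le>
      2 * ((real r)\<^sup>2 * sqrt (3 * real n) / real n) + 2 * exp 1 * real r * \<delta> powr (real r / 2)"
    if i: "i \<in> {1..r}" for i
  proof -
    have i1: "1 \<le> i" "i \<le> r" using i by auto
    have "(real (r choose i))\<^sup>2 / (real (n choose i) * p ^ (i choose 2)) =
        (real (r choose i))\<^sup>2 * (1 / real (n choose i)) * (1 / p ^ (i choose 2))"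
      by simp
    also have "\<dots> \<le> (real (r choose i))\<^sup>2 * (2 * fact i / real n ^ i) * v i ^ i"
      unfolding inverse_power_choose_two[OF p(1) i1(1)] q_def[symmetric] v_def[symmetric]
      using binomial_inverse_le[OF n r(2) i1(2)] vpos[of i]
      by (intro mult_right_mono mult_left_mono) auto
    finally have T: "(real (r choose i))\<^sup>2 / (real (n choose i) * p ^ (i choose 2)) \<le>
      (real (r choose i))\<^sup>2 * (2 * fact i / real n ^ i) * v i ^ i" .
    show ?thesis
    proof (cases "2 * i \<le> r")
      case True
      \<comment> \<open>As \<open>2 * i <= r\<close>, the exponent \<open>i - 1\<close> is at most
        \<open>(r - 1) / 2\<close>. Hence \<open>v i\<close> is at most the square root of
        \<open>w\<close>, and so of \<open>exp 1 * n\<close>; the 3 is an upper bound for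
        \<open>exp 1\<close>.\<close>
      have "(v i)\<^sup>2 = q powr (real i - 1)"
        using q by (simp add: v_def power2_eq_square flip: powr_add)
      also have "\<dots> \<le> w"
        unfolding w_def using q True by (intro powr_mono) auto
      also have "\<dots> \<le> real r * w" using r(1) q by (simp add: w_def)
      also have "\<dots> \<le> exp 1 * real n * 1"
        using critical \<delta> npos unfolding w_def by (meson less_eq_real_def mult_left_mono order_trans zero_le_mult_iff exp_ge_zero)
      also have "\<dots> \<le> 3 * real n"
        using exp_le npos by simp
      finally have vs: "v i \<le> sqrt (3 * real n)" by (rule real_le_rsqrt)
      \<comment> \<open>One binomial absorbs the factorial, the other is bounded alone. The term is
        then at most twice the \<open>i\<close>-th power of a number that \<open>small\<close> keeps
        at most 1, so \<open>i = 1\<close> is the worst case.\<close>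
      have c: "real (r choose i) * fact i \<le> real r ^ i"
        using binomial_fact_pow[of r i] by (metis of_nat_fact of_nat_le_iff of_nat_mult of_nat_power)
      have c2: "real (r choose i) \<le> real r ^ i"
        using binomial_le_pow[OF i1(2)] by (metis of_nat_le_iff of_nat_power)
      have "(real (r choose i))\<^sup>2 * (2 * fact i / real n ^ i) * v i ^ i
         = 2 * (real (r choose i) * (real (r choose i) * fact i)) * v i ^ i / real n ^ i"
        by (simp add: power2_eq_square)
      also have "\<dots> \<le> 2 * (real r ^ i * real r ^ i) * sqrt (3 * real n) ^ i / real n ^ i"
        using c c2 vs vpos[of i] by (intro divide_right_mono mult_mono power_mono mult_nonneg_nonneg) auto
      also have "\<dots> = 2 * ((real r)\<^sup>2 * sqrt (3 * real n) / real n) ^ i"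
        by (simp add: power_divide power_mult_distrib power2_eq_square)
      also have "\<dots> \<le> 2 * ((real r)\<^sup>2 * sqrt (3 * real n) / real n) ^ 1"
        using small i1 by (intro mult_left_mono power_decreasing) auto
      finally show ?thesis using T r \<delta> by (smt (verit) power_one_right powr_ge_zero mult_nonneg_nonneg exp_ge_zero of_nat_0_le_iff)
    next
      case False
      \<comment> \<open>Near full overlap everything is measured by the defect \<open>k\<close>: the
        binomial is at most \<open>r ^ k\<close>, and \<open>v i\<close> is smaller than
        \<open>w\<close> by the factor \<open>q powr (- k / 2)\<close>.\<close>
      define k where "k = r - i"
      have k: "real k = real r - real i" "k \<le> r" using i1 by (auto simp: k_def)
      have "r choose i = r choose k" using binomial_symmetric[OF i1(2)] by (simp add: k_def)
      then have c: "real (r choose i) \<le> real r ^ k"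
        using binomial_le_pow[OF k(2)] by (metis of_nat_le_iff of_nat_power)
      have f: "fact i \<le> exp 1 * real r * (real i / exp 1) ^ i"
      proof -
        have "exp 1 * real i * (real i / exp 1) ^ i \<le> exp 1 * real r * (real i / exp 1) ^ i"
          using i1 by (intro mult_right_mono mult_left_mono) auto
        then show ?thesis using fact_le_exp_power[OF i1(1)] by linarith
      qed
      have "(real i - 1) / 2 = (real r - 1) / 2 + - real k / 2" by (simp add: k field_simps)
      then have vw: "v i = w * q powr (- real k / 2)"
        unfolding v_def w_def by (simp only: powr_add)
      have base: "real i * v i / (exp 1 * real n) \<le> \<delta> * q powr (- real k / 2)"
      proof -
        have "real i * v i \<le> (real r * w) * q powr (- real k / 2)"
          unfolding vw mult.assoc[symmetric] using i1 by (intro mult_right_mono) (auto simp: w_def)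
        also have "\<dots> \<le> (exp 1 * real n * \<delta>) * q powr (- real k / 2)"
          using critical unfolding w_def by (intro mult_right_mono) auto
        finally show ?thesis using npos by (simp add: field_simps)
      qed
      \<comment> \<open>As \<open>i > r / 2\<close>, the exponent \<open>r / 4\<close> in
        \<open>large\<close> is at most \<open>i / 2\<close>.\<close>
      have rk: "(real r)\<^sup>2 * q powr (- real i / 2) \<le> 1"
      proof -
        have "(real r)\<^sup>2 \<le> q powr (real i / 2)"
          using large q False by (intro order.trans[OF large] powr_mono) auto
        then have "(real r)\<^sup>2 * q powr (- real i / 2) \<le> q powr (real i / 2) * q powr (- real i / 2)"
          by (intro mult_right_mono) auto
        then show ?thesis using q by (simp flip: powr_add)
      qed
      \<comment> \<open>Swapping the exponents \<open>i\<close> and \<open>k\<close> pairs each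
        \<open>r^2\<close> with \<open>q powr (- i / 2)\<close>. By \<open>rk\<close> these products
        are at most 1, and only \<open>\<delta> ^ i\<close> is left.\<close>
      have "(real r)\<^sup>2 ^ k * (\<delta> * q powr (- real k / 2)) ^ i = (real r)\<^sup>2 ^ k * (\<delta> ^ i * (q powr (- real i / 2)) ^ k)"
        using q by (simp add: power_mult_distrib powr_powr mult_ac flip: powr_realpow)
      also have "\<dots> = \<delta> ^ i * ((real r)\<^sup>2 * q powr (- real i / 2)) ^ k"
        by (simp add: power_mult_distrib mult_ac)
      also have "\<dots> \<le> \<delta> ^ i * 1"
        using rk \<delta> by (intro mult_left_mono power_le_one) auto
      also have "\<delta> ^ i * 1 = \<delta> powr real i" using \<delta> by (simp add: powr_realpow)
      also have "\<dots> \<le> \<delta> powr (real r / 2)"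
        using False \<delta> by (intro powr_mono') auto
      finally have tail: "(real r)\<^sup>2 ^ k * (\<delta> * q powr (- real k / 2)) ^ i \<le> \<delta> powr (real r / 2)" .
      have "(real (r choose i))\<^sup>2 * (2 * fact i / real n ^ i) * v i ^ i
         \<le> (real r ^ k)\<^sup>2 * (2 * (exp 1 * real r * (real i / exp 1) ^ i) / real n ^ i) * v i ^ i"
        using c f vpos[of i] by (intro mult_right_mono mult_mono power_mono divide_right_mono mult_left_mono) auto
      also have "\<dots> = 2 * exp 1 * real r * ((real r)\<^sup>2 ^ k * (real i * v i / (exp 1 * real n)) ^ i)"
        by (simp add: power_divide power_mult_distrib field_simps flip: power_mult)
      also have "\<dots> \<le> 2 * exp 1 * real r * ((real r)\<^sup>2 ^ k * (\<delta> * q powr (- real k / 2)) ^ i)"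
        using base vpos[of i] by (intro mult_left_mono power_mono) auto
      also have "\<dots> \<le> 2 * exp 1 * real r * \<delta> powr (real r / 2)"
        using tail by (intro mult_left_mono) auto
      finally have "(real (r choose i))\<^sup>2 * (2 * fact i / real n ^ i) * v i ^ i \<le> 2 * exp 1 * real r * \<delta> powr (real r / 2)" .
      moreover have "(real r)\<^sup>2 * sqrt (3 * real n) / real n \<ge> 0" by simp
      ultimately show ?thesis using T by linarith
    qed
  qed
  show ?thesis
    unfolding overlap_sum_def using sum_bounded_above[of "{1..r}", OF T_le] by simp
qed

section \<open>Asymptotics at the threshold\<close>

text \<open>Eventually \<open>r n\<close> is at most \<open>2 * log q n\<close>, so its powers are
  negligible against the square root of \<open>n\<close>; it also tends to infinity, so exponential
  gains in \<open>r n\<close> beat its powers. The choice of \<open>z\<close> supplies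
  \<open>critical\<close>, and \<open>overlap_sum_le\<close> applies for large
  \<open>n\<close>.\<close>

lemma overlap_sum_tendsto_0:
  fixes p \<epsilon> :: real
  assumes p: "0 < p" "p < 1" and \<epsilon>: "\<epsilon> > 0"
  defines "r \<equiv> \<lambda>n. nat \<lfloor>z_threshold n p - \<epsilon>\<rfloor>"
  shows "filterlim r at_top sequentially"
    and "eventually (\<lambda>n. r n \<le> n) sequentially"
    and "(\<lambda>n. overlap_sum n (r n) p) \<longlonglongrightarrow> 0"
proof -
  define c where "c = ln (1 / p)"
  have c: "c > 0" using p by (simp add: c_def)
  define q where "q = 1 / p"
  have q: "q > 1" using p by (simp add: q_def)
  have lq: "log q x = ln x / c" for x by (simp add: log_def c_def q_def)
  define \<delta> where "\<delta> = q powr (- \<epsilon> / 2)"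
  have \<delta>: "0 < \<delta>" "\<delta> < 1" using q \<epsilon> by (auto simp: \<delta>_def powr_less_one)
  define L where "L n = log q (real n)" for n :: nat
  define zz where "zz n = z_threshold n p - \<epsilon>" for n
  have zz: "zz n = 2 * (ln n / c) - 2 * (ln (ln n / c) / c) + 2 * (ln (exp 1 / 2) / c) + 1 - \<epsilon>" for n
    by (simp add: zz_def z_threshold_def Let_def lq flip: q_def)
  have zlim: "filterlim zz at_top sequentially"
    unfolding zz using c by real_asymp
  \<comment> \<open>The term \<open>- 2 * log q (L n)\<close> tends to minus infinity and absorbs
    the constants of \<open>z\<close>.\<close>
  have zL: "eventually (\<lambda>n. zz n \<le> 2 * L n) sequentially"
    unfolding zz L_def lq using c by real_asymp
  have rlim: "filterlim (\<lambda>n. real (r n)) at_top sequentially"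
  proof (rule filterlim_at_top_mono)
    show "filterlim (\<lambda>n. -1 + zz n) at_top sequentially"
      by (rule filterlim_tendsto_add_at_top[OF tendsto_const zlim])
    show "eventually (\<lambda>n. -1 + zz n \<le> real (r n)) sequentially"
      by (intro always_eventually allI) (simp add: r_def zz_def, linarith)
  qed
  show "filterlim r at_top sequentially"
    using rlim by (simp add: filterlim_sequentially_iff_filterlim_real)
  \<comment> \<open>\<open>nat\<close> sends a negative floor to 0, so the bound is drawn only once
    \<open>zz n\<close> is nonnegative.\<close>
  have rz: "eventually (\<lambda>n. real (r n) \<le> zz n) sequentially"
    using zlim[unfolded filterlim_at_top, rule_format, of 0]
    by eventually_elim (simp add: r_def zz_def)
  have rL: "eventually (\<lambda>n. real (r n) \<le> 2 * L n) sequentially"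
    using rz zL by eventually_elim simp
  have r1: "eventually (\<lambda>n. 1 \<le> real (r n)) sequentially"
    using rlim unfolding filterlim_at_top by blast
  have n1: "eventually (\<lambda>n. 1 \<le> (n::nat)) sequentially" by (rule eventually_ge_at_top)
  have "eventually (\<lambda>n. 2 * (2 * L n)\<^sup>2 \<le> real n) sequentially"
    unfolding L_def lq using c by real_asymp
  with rL r1 have r2: "eventually (\<lambda>n. 2 * (r n)\<^sup>2 \<le> n) sequentially"
  proof eventually_elim
    case (elim n)
    have "2 * (real (r n))\<^sup>2 \<le> 2 * (2 * L n)\<^sup>2" using elim by (intro mult_left_mono power_mono) auto
    with elim have "real (2 * (r n)\<^sup>2) \<le> real n" by simp
    then show ?case by (simp only: of_nat_le_iff)
  qed
  show "eventually (\<lambda>n. r n \<le> n) sequentially"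
    using r2
  proof eventually_elim
    case (elim n)
    have "r n \<le> 2 * (r n)\<^sup>2" by (simp add: power2_eq_square)
    with elim show ?case by simp
  qed
  have Lpos: "eventually (\<lambda>n. L n > 0) sequentially"
    unfolding L_def lq using c by real_asymp
  \<comment> \<open>The shape of \<open>z\<close> is made for this:
    \<open>q powr ((zz n - 1) / 2)\<close> equals \<open>n / L n * (e / 2) * \<delta>\<close>, and
    the factor \<open>r n <= 2 * L n\<close> cancels both \<open>L n\<close> and the 2.\<close>
  have crit: "eventually (\<lambda>n. real (r n) * q powr ((real (r n) - 1) / 2) \<le> exp 1 * real n * \<delta>) sequentially"
    using rz rL n1 Lpos
  proof eventually_elim
    case (elim n)
    have "q powr ((real (r n) - 1) / 2) \<le> q powr ((zz n - 1) / 2)"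
      using elim q by (intro powr_mono) auto
    also have "(zz n - 1) / 2 = log q (real n) - log q (L n) + log q (exp 1 / 2) + (- \<epsilon> / 2)"
      by (simp add: zz_def z_threshold_def Let_def L_def field_simps flip: q_def)
    also have "q powr \<dots> = real n / L n * (exp 1 / 2) * \<delta>"
      using elim q by (simp only: powr_add powr_diff \<delta>_def) (simp add: powr_log_cancel)
    finally have "real (r n) * q powr ((real (r n) - 1) / 2) \<le> (2 * L n) * (real n / L n * (exp 1 / 2) * \<delta>)"
      using elim by (intro mult_mono) auto
    also have "\<dots> = exp 1 * real n * \<delta>" using elim by simp
    finally show ?case .
  qed
  have sm: "eventually (\<lambda>n. (real (r n))\<^sup>2 * sqrt (3 * real n) / real n \<le> 1) sequentially"
  proof -
    have "eventually (\<lambda>n. (2 * L n)\<^sup>2 * sqrt (3 * real n) / real n \<le> 1) sequentially"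
      unfolding L_def lq using c by real_asymp
    with rL show ?thesis
    proof eventually_elim
      case (elim n)
      have "(real (r n))\<^sup>2 * sqrt (3 * real n) / real n \<le> (2 * L n)\<^sup>2 * sqrt (3 * real n) / real n"
        using elim by (intro divide_right_mono mult_right_mono power_mono) auto
      with elim show ?case by simp
    qed
  qed
  have la: "eventually (\<lambda>n. (real (r n))\<^sup>2 \<le> q powr (real (r n) / 4)) sequentially"
  proof -
    have "eventually (\<lambda>x::real. x\<^sup>2 \<le> q powr (x / 4)) at_top" using q by real_asymp
    then show ?thesis by (rule eventually_compose_filterlim[OF _ rlim])
  qed
  \<comment> \<open>The bound of \<open>overlap_sum_le\<close> multiplied out: the first part is at
    most of order \<open>(log n)^3 / sqrt n\<close>, the second is \<open>r^2\<close> times a factor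
    decaying exponentially in \<open>r\<close>.\<close>
  define h where "h n = real (r n) * (2 * ((real (r n))\<^sup>2 * sqrt (3 * real n) / real n)) +
    2 * exp 1 * (real (r n))\<^sup>2 * \<delta> powr (real (r n) / 2)" for n
  have "(\<lambda>n. real (r n) * (2 * ((real (r n))\<^sup>2 * sqrt (3 * real n) / real n))) \<longlonglongrightarrow> 0"
  proof (rule tendsto_sandwich[OF _ _ tendsto_const])
    show "(\<lambda>n. (2 * L n) * (2 * ((2 * L n)\<^sup>2 * sqrt (3 * real n) / real n))) \<longlonglongrightarrow> 0"
      unfolding L_def lq using c by real_asymp
    show "eventually (\<lambda>n. real (r n) * (2 * ((real (r n))\<^sup>2 * sqrt (3 * real n) / real n)) \<le>
       (2 * L n) * (2 * ((2 * L n)\<^sup>2 * sqrt (3 * real n) / real n))) sequentially"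
      using rL by eventually_elim (intro mult_mono divide_right_mono mult_left_mono power_mono, auto)
  qed auto
  moreover have "(\<lambda>n. 2 * exp 1 * (real (r n))\<^sup>2 * \<delta> powr (real (r n) / 2)) \<longlonglongrightarrow> 0"
  proof -
    have "((\<lambda>x::real. 2 * exp 1 * x\<^sup>2 * \<delta> powr (x / 2)) \<longlongrightarrow> 0) at_top"
      using \<delta> by real_asymp
    then show ?thesis by (rule filterlim_compose[OF _ rlim])
  qed
  ultimately have hlim: "h \<longlonglongrightarrow> 0" unfolding h_def[abs_def] by (rule tendsto_add_zero)
  show "(\<lambda>n. overlap_sum n (r n) p) \<longlonglongrightarrow> 0"
  proof (rule tendsto_sandwich[OF _ _ tendsto_const hlim])
    show "eventually (\<lambda>n. overlap_sum n (r n) p \<le> h n) sequentially"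
      using r1 n1 r2 crit sm la
    proof eventually_elim
      case (elim n)
      have "overlap_sum n (r n) p \<le> real (r n) * (2 * ((real (r n))\<^sup>2 * sqrt (3 * real n) / real n) +
          2 * exp 1 * real (r n) * \<delta> powr (real (r n) / 2))"
        using elim p \<delta> by (intro overlap_sum_le) (auto simp: q_def)
      then show ?case by (simp add: h_def algebra_simps power2_eq_square)
    qed
    show "eventually (\<lambda>n. 0 \<le> overlap_sum n (r n) p) sequentially"
      using p by (auto simp: overlap_sum_def intro!: sum_nonneg always_eventually)
  qed
qed

section \<open>Multi-cliques in the random graph\<close>

text \<open>\<open>prob_independent_subfamily\<close> is applied to the events that an
  \<open>r\<close>-set is a clique, with intersection of vertex sets as the relation. Disjoint
  vertex sets span no common edge, so unrelated events are independent, and \<open>Suc s\<close>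
  unrelated events that occur together yield a multi-clique.\<close>

lemma prob_multi_clique_ge:
  fixes p :: real
  assumes p: "0 < p" "p \<le> 1" and rn: "1 \<le> r" "r \<le> n"
  shows "1 - 2 * real (Suc s) * overlap_sum n r p
    \<le> measure_pmf.prob (erdos_renyi n p) {\<Gamma>. \<exists>Vs. multi_clique \<Gamma> (Suc s) (int r) Vs}"
proof -
  define W where "W = all_edges {1..n}"
  define M where "M = Pi_pmf W False (\<lambda>_. bernoulli_pmf p)"
  define K where "K = {A. A \<subseteq> {1..n} \<and> card A = r}"
  define E where "E A = {f. \<forall>e\<in>all_edges A. f e}" for A :: "nat set"
  define G where "G = {f. \<exists>Vs. multi_clique ({1..n}, {e \<in> W. f e}) (Suc s) (int r) Vs}"
  define m where "m = p ^ (r choose 2)"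
  have finK: "finite K" by (rule finite_subset[of _ "Pow {1..n}"]) (auto simp: K_def)
  have cardK: "card K = n choose r" using n_subsets[of "{1..n}" r] by (simp add: K_def)
  have fin: "finite A" if "A \<in> K" for A
    using that finite_subset[of A "{1..n}"] by (simp add: K_def)
  have sub: "all_edges A \<subseteq> W" if "A \<in> K" for A
    using that all_edges_mono[of A "{1..n}"] by (simp add: K_def W_def)
  have PEE: "measure_pmf.prob M (E A \<inter> E B) = p ^ card (all_edges A \<union> all_edges B)"
    if "A \<in> K" "B \<in> K" for A B
  proof -
    have "E A \<inter> E B = {f. \<forall>e\<in>all_edges A \<union> all_edges B. f e}" by (auto simp: E_def)
    then show ?thesis
      unfolding M_def using sub[OF that(1)] sub[OF that(2)] p
      by (simp only:) (rule prob_all_present, auto simp: W_def)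
  qed
  have PE: "measure_pmf.prob M (E A) = m" if "A \<in> K" for A
    using PEE[OF that that] that fin[OF that] by (simp add: card_all_edges m_def K_def)
  have mu: "(\<Sum>A\<in>K. measure_pmf.prob M (E A)) = real (n choose r) * m"
    using PE cardK by simp
  have mupos: "real (n choose r) * m > 0" using rn p by (simp add: m_def)
  have "1 - 2 * real (Suc s) * (\<Sum>A\<in>K. \<Sum>B | B \<in> K \<and> \<not> disjnt A B. measure_pmf.prob M (E A \<inter> E B))
      / (\<Sum>A\<in>K. measure_pmf.prob M (E A))\<^sup>2 \<le> measure_pmf.prob M G"
  proof (rule measure_pmf.prob_independent_subfamily[OF finK])
    \<comment> \<open>The empty set is disjoint from itself; \<open>1 <= r\<close> excludes it and
      makes the relation reflexive on \<open>K\<close>.\<close>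
    show "\<not> disjnt A A" if "A \<in> K" for A
      using that rn by (auto simp: K_def disjnt_def)
    show "measure_pmf.prob M (E A \<inter> E B) \<le> measure_pmf.prob M (E A) * measure_pmf.prob M (E B)"
      if AB: "A \<in> K" "B \<in> K" "\<not> \<not> disjnt A B" for A B
    proof -
      have "all_edges A \<inter> all_edges B = {}"
        using AB(3) by (simp add: all_edges_Int disjnt_def) (simp add: all_edges_def)
      then have "card (all_edges A \<union> all_edges B) = card (all_edges A) + card (all_edges B)"
        using fin[OF AB(1)] fin[OF AB(2)] by (intro card_Un_disjoint) auto
      then have "p ^ card (all_edges A \<union> all_edges B) = m * m"
        using AB fin[OF AB(1)] fin[OF AB(2)] by (simp add: card_all_edges m_def K_def power_add)
      then show ?thesis using AB by (simp add: PE PEE)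
    qed
    show "f \<in> G" if S: "S \<subseteq> K" "card S = Suc s" "pairwise (\<lambda>A B. \<not> \<not> disjnt A B) S" "\<forall>A\<in>S. f \<in> E A" for f S
      unfolding G_def W_def mem_Collect_eq
      by (rule multi_clique_of_disjoint_cliques[OF S(2)]) (use S in \<open>auto simp: K_def E_def\<close>)
    show "(\<Sum>A\<in>K. measure_pmf.prob M (E A)) > 0" using mu mupos by simp
  qed (auto simp: disjnt_sym)
  moreover have "(\<Sum>A\<in>K. \<Sum>B | B \<in> K \<and> \<not> disjnt A B. measure_pmf.prob M (E A \<inter> E B))
      \<le> (real (n choose r) * m)\<^sup>2 * overlap_sum n r p"
  proof -
    have "(\<Sum>A\<in>K. \<Sum>B | B \<in> K \<and> \<not> disjnt A B. measure_pmf.prob M (E A \<inter> E B)) =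
        (\<Sum>A\<in>K. \<Sum>B | B \<in> K \<and> \<not> disjnt A B. p ^ card (all_edges A \<union> all_edges B))"
      by (intro sum.cong refl PEE) auto
    then show ?thesis using clique_overlap_bound[OF p rn, folded K_def m_def] by simp
  qed
  then have "(\<Sum>A\<in>K. \<Sum>B | B \<in> K \<and> \<not> disjnt A B. measure_pmf.prob M (E A \<inter> E B))
      / (real (n choose r) * m)\<^sup>2 \<le> overlap_sum n r p"
    using zero_less_power[OF mupos, of 2] by (simp only: pos_divide_le_eq mult.commute)
  then have "2 * real (Suc s) * ((\<Sum>A\<in>K. \<Sum>B | B \<in> K \<and> \<not> disjnt A B. measure_pmf.prob M (E A \<inter> E B))
      / (real (n choose r) * m)\<^sup>2) \<le> 2 * real (Suc s) * overlap_sum n r p"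
    by (intro mult_left_mono) auto
  ultimately have "1 - 2 * real (Suc s) * overlap_sum n r p \<le> measure_pmf.prob M G"
    unfolding mu times_divide_eq_right by linarith
  also have "measure_pmf.prob M G =
      measure_pmf.prob (erdos_renyi n p) {\<Gamma>. \<exists>Vs. multi_clique \<Gamma> (Suc s) (int r) Vs}"
    by (simp add: erdos_renyi_def G_def M_def W_def vimage_def)
  finally show ?thesis .
qed

theorem theorem1p3:
  fixes s :: nat and \<epsilon> p :: real
  assumes "s > 0" and "\<epsilon> > 0" and "0 < p" and "p < 1"
  shows "(\<lambda>n. measure_pmf.prob (erdos_renyi n p)
            {\<Gamma>. \<exists>Vs. multi_clique \<Gamma> s \<lfloor>z_threshold n p - \<epsilon>\<rfloor> Vs}) \<longlonglongrightarrow> 1"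
proof -
  define r where "r n = nat \<lfloor>z_threshold n p - \<epsilon>\<rfloor>" for n
  note lim = overlap_sum_tendsto_0[OF assms(3,4,2), folded r_def]
  obtain s' where s: "s = Suc s'" using assms(1) gr0_implies_Suc by blast
  have "eventually (\<lambda>n. 1 \<le> r n) sequentially"
    using lim(1) unfolding filterlim_at_top by blast
  with lim(2) have lower: "eventually (\<lambda>n. 1 - 2 * real s * overlap_sum n (r n) p \<le>
      measure_pmf.prob (erdos_renyi n p) {\<Gamma>. \<exists>Vs. multi_clique \<Gamma> s \<lfloor>z_threshold n p - \<epsilon>\<rfloor> Vs}) sequentially"
  proof eventually_elim
    case (elim n)
    \<comment> \<open>Since \<open>1 <= r n\<close>, the floor is positive and \<open>nat\<close>
      has not truncated it.\<close>
    then have "int (r n) = \<lfloor>z_threshold n p - \<epsilon>\<rfloor>" unfolding r_def by linarith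
    with prob_multi_clique_ge[of p "r n" n s'] elim assms s show ?case by simp
  qed
  have "(\<lambda>n. 1 - 2 * real s * overlap_sum n (r n) p) \<longlonglongrightarrow> 1 - 2 * real s * 0"
    by (intro tendsto_intros lim(3))
  then show ?thesis
    by (intro tendsto_sandwich[OF lower always_eventually _ tendsto_const]) auto
qed

end
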